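(* Let $f:\mathbb{Z}^2\to\mathbb{R}$ be a function vanishing at infinity and let $f^*:\mathbb{Z}^2\to\mathbb{R}_{\ge 0}$ denote the Wang-Wang rearrangement of $f$. Then, for all $1\le p\le\infty$, $$\|\nabla f^*\|_{p}\le 2^{1/p}\,\|\nabla f\|_{p},$$ where $1/\infty:=0$ and the inequality is understood in $[0,\infty]$.
   Context: $\mathbb{Z}^2$ carries the standard lattice graph structure: $x\sim y$ if and only if $\|x-y\|_{\ell^1}=1$. For $g:\mathbb{Z}^2\to\mathbb{R}$ and $1\le p<\infty$, $\|\nabla g\|_p^p=\sum_{x\sim y}|g(x)-g(y)|^p$ (the sum runs once over each undirected edge), and $\|\nabla g\|_\infty=\sup_{x\sim y}|g(x)-g(y)|$. A function $f$ vanishes at infinity if $\{x:|f(x)|>t\}$ is finite for every $t>0$. Given a bijection $\eta:\{1,2,3,\dots\}\to\mathbb{Z}^2$ (a labelling), the associated rearrangement $f^*$ of $f$ is defined by $f^*(\eta(k)):=$ the $k$-th largest value assumed by $|f|$, counted with multiplicity (that is, the largest $t\ge 0$ such that $|f(x)|\ge t$ for at least $k$ points $x$). The Wang-Wang labelling of $\mathbb{Z}^2$ enumerates the points in order of increasing $\ell^1$-norm. Among the points $(x,y)$ of equal norm $r\ge 1$, first come those with $x\ge 1,\ y\ge 1$, then those with $x\le 0,\ y\ge 1$, then those with $x\ge 1,\ y\le 0$, then those with $x\le 0,\ y\le 0$; within each of these four groups the points are ordered by increasing $|y|$. The first 13 points are $(0,0)$, $(0,1)$, $(1,0)$, $(-1,0)$,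 $(0,-1)$, $(1,1)$, $(-1,1)$, $(0,2)$, $(2,0)$, $(1,-1)$, $(-2,0)$, $(-1,-1)$, $(0,-2)$. For every $n$, the first $n$ points of this enumeration have the smallest possible number of adjacent vertices (vertices outside the set having a neighbour in the set) among all $n$-element subsets of $\mathbb{Z}^2$. The Wang-Wang rearrangement is the rearrangement associated with this labelling. *)

theory Defs
  imports "HOL-Analysis.Analysis"
begin

type_synonym Z2 = "int \<times> int"

definition l1_norm :: "Z2 \<Rightarrow> int" where
  "l1_norm v = \<bar>fst v\<bar> + \<bar>snd v\<bar>"

definition adj :: "Z2 \<Rightarrow> Z2 \<Rightarrow> bool" where
  "adj v w \<longleftrightarrow> l1_norm (v - w) = 1"

(* Each undirected edge is represented by exactly one of its two orientations (the one pointing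
   right or up), so that a sum over this set counts each undirected edge once;
   see adj_iff_edges and edges_asym. *)
definition edges :: "(Z2 \<times> Z2) set" where
  "edges = {(v, w). adj v w \<and> (fst v < fst w \<or> snd v < snd w)}"

(* Real power of an extended nonnegative number, meant for positive exponents. *)
definition ennreal_rpow :: "ennreal \<Rightarrow> real \<Rightarrow> ennreal" where
  "ennreal_rpow s a = (if s = \<infinity> then \<infinity> else ennreal (enn2real s powr a))"

(* The l^p norm of the gradient with values in [0,\<infinity>], for 1 \<le> p \<le> \<infinity>.
   An infinite sum over ennreal always exists. *)
definition grad_norm :: "ennreal \<Rightarrow> (Z2 \<Rightarrow> real) \<Rightarrow> ennreal" where
  "grad_norm p g =
     (if p = \<infinity> then (SUP (v, w)\<in>edges. ennreal \<bar>g v - g w\<bar>)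
      else ennreal_rpow (\<Sum>\<^sub>\<infinity>(v, w)\<in>edges. ennreal (\<bar>g v - g w\<bar> powr enn2real p))
                        (1 / enn2real p))"

definition vanishes_at_infinity :: "('a \<Rightarrow> real) \<Rightarrow> bool" where
  "vanishes_at_infinity f \<longleftrightarrow> (\<forall>t>0. finite {x. \<bar>f x\<bar> > t})"

(* "At least k points" is expressed by a k-element subset, because for t = 0 the superlevel set
   is infinite and its card would be 0. *)
definition kth_largest :: "('a \<Rightarrow> real) \<Rightarrow> nat \<Rightarrow> real" where
  "kth_largest f k =
     (GREATEST t. t \<ge> 0 \<and> (\<exists>A. finite A \<and> card A = k \<and> (\<forall>x\<in>A. \<bar>f x\<bar> \<ge> t)))"

(* A labelling is a function eta on nat of which only the values at k \<ge> 1 matter. *)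
definition rearrangement :: "(nat \<Rightarrow> 'a) \<Rightarrow> ('a \<Rightarrow> real) \<Rightarrow> 'a \<Rightarrow> real" where
  "rearrangement \<eta> f x = kth_largest f (inv_into {1..} \<eta> x)"

definition ww_group :: "Z2 \<Rightarrow> nat" where
  "ww_group v =
     (if snd v \<ge> 1 then (if fst v \<ge> 1 then 1 else 2)
      else (if fst v \<ge> 1 then 3 else 4))"

definition ww_less :: "Z2 \<Rightarrow> Z2 \<Rightarrow> bool" where
  "ww_less v w \<longleftrightarrow>
     l1_norm v < l1_norm w \<or>
     l1_norm v = l1_norm w \<and>
       (ww_group v < ww_group w \<or>
        ww_group v = ww_group w \<and> \<bar>snd v\<bar> < \<bar>snd w\<bar>)"

(* The k-th point, k = 1, 2, ..., is the one with exactly k - 1 predecessors. *)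
definition ww_labelling :: "nat \<Rightarrow> Z2" where
  "ww_labelling k = (THE v. Suc (card {w. ww_less w v}) = k)"

definition ww_rearrangement :: "(Z2 \<Rightarrow> real) \<Rightarrow> Z2 \<Rightarrow> real" where
  "ww_rearrangement = rearrangement ww_labelling"


lemma adj_iff_edges: "adj v w \<longleftrightarrow> (v, w) \<in> edges \<or> (w, v) \<in> edges"
  by (auto simp: adj_def edges_def l1_norm_def)

lemma edges_asym: "(v, w) \<in> edges \<Longrightarrow> (w, v) \<notin> edges"
  by (auto simp: adj_def edges_def l1_norm_def)

lemma ww_less_irrefl: "\<not> ww_less v v"
  by (simp add: ww_less_def)

lemma ww_less_trans: "ww_less u v \<Longrightarrow> ww_less v w \<Longrightarrow> ww_less u w"
  by (auto simp: ww_less_def)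

lemma ww_less_total:
  assumes "v \<noteq> w"
  shows "ww_less v w \<or> ww_less w v"
proof (rule ccontr)
  assume "\<not> (ww_less v w \<or> ww_less w v)"
  hence eq: "l1_norm v = l1_norm w" "ww_group v = ww_group w" "\<bar>snd v\<bar> = \<bar>snd w\<bar>"
    unfolding ww_less_def by linarith+
  have "snd v \<ge> 1 \<longleftrightarrow> snd w \<ge> 1" "fst v \<ge> 1 \<longleftrightarrow> fst w \<ge> 1"
    using eq(2) by (simp_all add: ww_group_def split: if_splits)
  moreover have "\<bar>fst v\<bar> = \<bar>fst w\<bar>"
    using eq by (simp add: l1_norm_def)
  ultimately have "fst v = fst w" "snd v = snd w"
    using eq(3) by linarith+
  thus False using assms by (simp add: prod_eq_iff)
qed

lemma finite_ww_less: "finite {w. ww_less w v}"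
proof (rule finite_subset)
  define r where "r = l1_norm v"
  show "{w. ww_less w v} \<subseteq> {- r..r} \<times> {- r..r}"
    by (auto simp: ww_less_def l1_norm_def r_def)
qed simp

lemma card_ww_less_mono:
  assumes "ww_less v w"
  shows "card {u. ww_less u v} < card {u. ww_less u w}"
proof (rule psubset_card_mono[OF finite_ww_less])
  show "{u. ww_less u v} \<subset> {u. ww_less u w}"
    using assms ww_less_trans ww_less_irrefl by blast
qed

lemma bij_card_ww_less: "bij (\<lambda>v. card {w. ww_less w v})"
proof -
  let ?c = "\<lambda>v. card {w. ww_less w v}"
  have inj: "inj ?c"
    by (rule injI) (metis card_ww_less_mono less_irrefl ww_less_total)
  have down: "n \<in> range ?c" if "n < ?c v" for n v
  proof -
    have "?c ` {w. ww_less w v} = {..<?c v}"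
    proof (rule card_subset_eq)
      show "?c ` {w. ww_less w v} \<subseteq> {..<?c v}"
        by (intro image_subsetI) (simp add: card_ww_less_mono)
      show "card (?c ` {w. ww_less w v}) = card {..<?c v}"
        using card_image[OF inj_on_subset[OF inj]] by simp
    qed simp
    thus ?thesis using that by blast
  qed
  have "infinite (range ?c)"
    using inj finite_imageD infinite_UNIV_char_0[where 'a = int] finite_prod[where 'a = int and 'b = int]
    by blast
  hence "n \<in> range ?c" for n
    using down unfolding infinite_nat_iff_unbounded by blast
  thus ?thesis using inj by (auto simp: bij_def)
qed

lemma ww_labelling_eq_iff:
  assumes "k \<ge> 1"
  shows "ww_labelling k = v \<longleftrightarrow> Suc (card {w. ww_less w v}) = k"
proof -
  have "\<exists>!v. Suc (card {w. ww_less w v}) = k"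
    using assms bij_card_ww_less unfolding bij_iff
    by (metis One_nat_def Suc_le_D Suc_inject)
  from theI'[OF this] the1_equality[OF this] show ?thesis
    unfolding ww_labelling_def by blast
qed

lemma card_ww_labelling:
  "k \<ge> 1 \<Longrightarrow> Suc (card {w. ww_less w (ww_labelling k)}) = k"
  using ww_labelling_eq_iff by blast

lemma bij_betw_ww_labelling: "bij_betw ww_labelling {1..} UNIV"
  by (rule bij_betw_byWitness[where f' = "\<lambda>v. Suc (card {w. ww_less w v})"])
     (simp_all add: card_ww_labelling ww_labelling_eq_iff image_subset_iff del: split_paired_All)

lemma ww_labelling_less:
  assumes "1 \<le> j" "j < k"
  shows "ww_less (ww_labelling j) (ww_labelling k)"
proof -
  have "card {w. ww_less w (ww_labelling j)} < card {w. ww_less w (ww_labelling k)}"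
    using card_ww_labelling[of j] card_ww_labelling[of k] assms by linarith
  thus ?thesis
    using card_ww_less_mono ww_less_total by (metis less_asym less_irrefl)
qed

lemma kth_largest_greatest:
  fixes f :: "Z2 \<Rightarrow> real"
  assumes van: "vanishes_at_infinity f" and k: "k \<ge> 1"
  defines "P \<equiv> \<lambda>t. t \<ge> 0 \<and> (\<exists>A. finite A \<and> card A = k \<and> (\<forall>x\<in>A. \<bar>f x\<bar> \<ge> t))"
  shows "P (kth_largest f k)" and "P t \<Longrightarrow> t \<le> kth_largest f k"
proof -
  have ex: "\<exists>m. P m \<and> (\<forall>t. P t \<longrightarrow> t \<le> m)"
  proof (cases "\<exists>t>0. P t")
    case False
    have "infinite (UNIV :: Z2 set)"
      using infinite_UNIV_char_0[where 'a = int] finite_prod[where 'a = int and 'b = int] by blast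
    then obtain A :: "Z2 set" where "finite A" "card A = k"
      using infinite_arbitrarily_large by blast
    hence "P 0" by (auto simp: P_def)
    thus ?thesis using False by (meson not_le)
  next
    case True
    then obtain t0 where t0: "t0 > 0" "P t0" by blast
    let ?F = "{x. \<bar>f x\<bar> > t0 / 2}"
    let ?M = "(\<lambda>A. Min ((\<lambda>x. \<bar>f x\<bar>) ` A)) ` {A. A \<subseteq> ?F \<and> card A = k}"
    have fin: "finite ?F" using van t0(1) half_gt_zero unfolding vanishes_at_infinity_def by blast
    hence finM: "finite ?M" by simp
    have *: "\<exists>m\<in>?M. t \<le> m" if t: "P t" "t \<ge> t0" for t
    proof -
      obtain A where A: "finite A" "card A = k" "\<forall>x\<in>A. \<bar>f x\<bar> \<ge> t"
        using t(1) unfolding P_def by blast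
      have "A \<subseteq> ?F" using A(3) t(2) t0(1) by fastforce
      moreover have "t \<le> Min ((\<lambda>x. \<bar>f x\<bar>) ` A)" using A k by (subst Min_ge_iff) auto
      ultimately show ?thesis using A by blast
    qed
    have PM: "P m" if m: "m \<in> ?M" for m
    proof -
      obtain A where A: "A \<subseteq> ?F" "card A = k" "m = Min ((\<lambda>x. \<bar>f x\<bar>) ` A)"
        using m by blast
      have fA: "finite A" "A \<noteq> {}" using A k fin finite_subset by auto
      have "\<forall>x\<in>A. \<bar>f x\<bar> \<ge> m" using A fA by simp
      moreover have "m \<ge> 0" using A fA by simp
      ultimately show ?thesis using A fA by (auto simp: P_def)
    qed
    have ne: "?M \<noteq> {}" using *[OF t0(2)] by blast
    have "t \<le> Max ?M" if "P t" for t
    proof (cases "t \<ge> t0")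
      case True
      thus ?thesis using *[OF that] Max_ge[OF finM] by (meson order_trans)
    next
      case False
      thus ?thesis using *[OF t0(2)] Max_ge[OF finM] by (meson order_trans order_refl linear)
    qed
    thus ?thesis using PM[OF Max_in[OF finM ne]] by blast
  qed
  then obtain m where m: "P m" "\<And>t. P t \<Longrightarrow> t \<le> m" by blast
  have "kth_largest f k = m"
    unfolding kth_largest_def using m by (intro Greatest_equality) (auto simp: P_def)
  thus "P (kth_largest f k)" "P t \<Longrightarrow> t \<le> kth_largest f k"
    using m by auto
qed

end

theory Submission
  imports Defs
begin

text \<open>
  For a function $g$ on the lattice let \<open>peak g v\<close> be the maximum of $g$ over $v$ and its four
  neighbours. The proof for finite $p$ compares the gradients of $f$ and of its rearrangement $f^*$
  through the sum $K(g) = \sum_v (\mathrm{peak}\,g(v) - g(v))^p$, in three steps.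

  \<^item> $\|\nabla f^*\|_p^p \le 2 K(f^*)$ (\<open>energy_le_peak_energy\<close>): the ends of an edge have different
    norms, and $f^*$ is at least as large at the inner end as at the outer end, so the edge
    contributes at most the term of its outer end. A vertex is the outer end of at most one
    horizontal and one vertical edge; this is where the factor 2 comes from.
  \<^item> $K(f^*) \le K(|f|)$ (\<open>peak_energy_rearrangement_le\<close>).
  \<^item> $K(|f|) \le \|\nabla f\|_p^p$ (\<open>peak_energy_le_energy\<close>): a vertex with a nonzero term is charged to
    an edge leading to a neighbour of maximal value. It is the end of that edge at which $|f|$ is
    strictly smaller, so no edge is charged twice.

  For the middle step, write $(b - c)^p = \int_c^b p (u - c)^{p-1}\,du$. The points with
  $\mathrm{peak}\,g > u$ form the closed neighbourhood of the superlevel set $\{g > u\}$, hence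
  $K(g) = \int_0^\infty \sum_v p (u - g(v))_+^{p-1}\,du$, where $v$ runs over this neighbourhood. For
  fixed $u$ the inner sum of a decreasing function of $g(v)$ is as small as possible if the
  neighbourhood has as few points as possible and contains the points with the largest values of
  $g$. Both hold for $f^*$, because the initial segments of the Wang-Wang order have the
  following two properties:

  \<^item> the closed neighbourhood of an initial segment is an initial segment (\<open>nbhd_segment\<close>);
  \<^item> among all sets of the same size an initial segment has the smallest closed neighbourhood
    (\<open>ww_segments_optimal\<close>).

  The second property follows from the isoperimetric inequality
  $8 |A| \le (b - 2)^2 + 4$ for a finite nonempty set $A$ with $b$ adjacent vertices
  (\<open>vertex_isoperimetric\<close>), since the right-hand side with $b - 1$ in place of $b$ is too small for
  an initial segment. The inequality itself is proved by cutting $A$ along the lines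
  $x + y = k$: a line that meets $A$ in $n_k > 0$ points forces at least $n_k + 1$ points of the
  closed neighbourhood on each of the two adjacent lines, and the rest is a statement about the
  sequence $n_k$ (\<open>profile_isoperimetric\<close>).

  For $p = \infty$ the two properties give the inequality directly: if $f$ changes by at most $D$
  along every edge, then $\{|f| > s\}$ contains the closed neighbourhood of $\{|f| > s + D\}$, and therefore
  $\{f^* > s\}$ contains the closed neighbourhood of $\{f^* > s + D\}$.
\<close>

section \<open>The isoperimetric inequality for integer profiles\<close>

text \<open>
  The sum telescopes: its terms are at least $n_{k-1} + 1 - n_k$ where $n_{k-1} > 0$, and
  nonnegative elsewhere. The value at the first position after a gap is therefore not subtracted,
  and this gain is recorded as an additional 1.
\<close>

lemma outward_boundary:
  fixes n N :: "int \<Rightarrow> int"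
  assumes fin: "finite T"
    and nonneg: "\<And>k. 0 \<le> n k" and le: "\<And>k. n k \<le> N k"
    and step: "\<And>k. 0 < n (k - 1) \<Longrightarrow> n (k - 1) + 1 \<le> N k"
    and supp: "\<And>k. 0 < N k \<Longrightarrow> k \<in> T"
    and k0: "0 < n k0"
  shows "n k0 + int (card {k. 0 < n k \<and> k0 \<le> k})
           + (if \<exists>k>k0. 0 < n k \<and> n (k - 1) = 0 then 1 else 0)
         \<le> (\<Sum>k \<in> {k\<in>T. k0 < k}. N k - n k)"
proof -
  define U where "U = {k. 0 < n k \<and> k0 \<le> k}"
  define P where "P = (\<lambda>k. k + 1) ` U"
  define V where "V = {k. 0 < n k \<and> k0 < k}"
  have ST: "k \<in> T" if "0 < n k" for k using le[of k] supp[of k] that by linarith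
  have finU: "finite U" and finV: "finite V"
    by (rule finite_subset[OF _ fin]; auto simp: U_def V_def ST)+
  have UV: "U = insert k0 V" "k0 \<notin> V" using k0 by (auto simp: U_def V_def)
  have PT: "P \<subseteq> {k\<in>T. k0 < k}"
  proof
    fix k assume "k \<in> P"
    then have "0 < n (k - 1)" "k0 < k" by (auto simp: P_def U_def)
    then show "k \<in> {k\<in>T. k0 < k}" using step[of k] supp[of k] by auto
  qed
  have "(\<Sum>k\<in>P. n k) + (if \<exists>k>k0. 0 < n k \<and> n (k - 1) = 0 then 1 else 0) \<le> (\<Sum>k\<in>V. n k)"
  proof -
    have "(\<Sum>k\<in>P. n k) = (\<Sum>k\<in>P \<inter> V. n k)"
    proof (rule sum.mono_neutral_right)
      show "finite P" using finU by (simp add: P_def)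
      have "n k = 0" if "k \<in> P" "k \<notin> V" for k
        using that nonneg[of k] by (auto simp: P_def V_def U_def)
      thus "\<forall>i\<in>P - P \<inter> V. n i = 0" by blast
    qed auto
    moreover have "(\<Sum>k\<in>V. n k) = (\<Sum>k\<in>P \<inter> V. n k) + (\<Sum>k\<in>V - P. n k)"
      using sum.Int_Diff[OF finV, of n P] by (simp add: Int_commute)
    moreover have "(if \<exists>k>k0. 0 < n k \<and> n (k - 1) = 0 then 1 else 0) \<le> (\<Sum>k\<in>V - P. n k)"
    proof (cases "\<exists>k>k0. 0 < n k \<and> n (k - 1) = 0")
      case True
      then obtain k where k: "k > k0" "0 < n k" "n (k - 1) = 0" by blast
      then have "k \<in> V - P" by (auto simp: V_def P_def U_def)
      then have "n k \<le> (\<Sum>k\<in>V - P. n k)"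
        by (intro member_le_sum) (auto simp: nonneg finV)
      thus ?thesis using k True by simp
    next
      case False
      thus ?thesis by (simp only: if_False) (intro sum_nonneg nonneg)
    qed
    ultimately show ?thesis by linarith
  qed
  moreover have "(\<Sum>k\<in>P. n (k - 1) + 1 - n k) \<le> (\<Sum>k \<in> {k\<in>T. k0 < k}. N k - n k)"
  proof -
    have "(\<Sum>k\<in>P. n (k - 1) + 1 - n k) \<le> (\<Sum>k\<in>P. N k - n k)"
    proof (rule sum_mono)
      fix k assume "k \<in> P"
      hence "0 < n (k - 1)" by (auto simp: P_def U_def)
      thus "n (k - 1) + 1 - n k \<le> N k - n k" using step[of k] by simp
    qed
    also have "\<dots> \<le> (\<Sum>k \<in> {k\<in>T. k0 < k}. N k - n k)"
      by (rule sum_mono2) (use fin PT le in auto)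
    finally show ?thesis .
  qed
  moreover have "(\<Sum>k\<in>P. n (k - 1) + 1 - n k) = (\<Sum>k\<in>U. n k + 1) - (\<Sum>k\<in>P. n k)"
    by (simp add: sum_subtractf) (simp add: P_def sum.reindex)
  moreover have "(\<Sum>k\<in>U. n k + 1) = (\<Sum>k\<in>U. n k) + int (card U)"
    by (simp add: sum.distrib)
  moreover have "(\<Sum>k\<in>U. n k) = n k0 + (\<Sum>k\<in>V. n k)" using UV finV by simp
  ultimately show ?thesis unfolding U_def[symmetric] by linarith
qed

text \<open>
  Let $M$ be the maximum of $n$, attained at \<open>k0\<close>, and $L$ the number of nonzero positions.
  Telescoping from \<open>k0\<close> in both directions gives $b \ge 2M + L + 1$. Together with
  $\sum n_k \le LM$ and the inequality of arithmetic and geometric means this yields only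
  $8 \sum n_k \le (b - 1)^2$. The missing amount comes from one of two sources. If the support has
  a gap, or two consecutive values equal $M$, then the lower bound for $b$ improves by 1. Otherwise
  the support is an interval and two consecutive values add up to at most $2M - 1$, which improves
  the upper bound for the sum to $2 \sum n_k \le 2LM - (L - 1)$.
\<close>

lemma profile_isoperimetric:
  fixes n N :: "int \<Rightarrow> int"
  assumes fin: "finite T"
    and nonneg: "\<And>k. 0 \<le> n k" and le: "\<And>k. n k \<le> N k"
    and up: "\<And>k. 0 < n (k - 1) \<Longrightarrow> n (k - 1) + 1 \<le> N k"
    and down: "\<And>k. 0 < n (k + 1) \<Longrightarrow> n (k + 1) + 1 \<le> N k"
    and supp: "\<And>k. 0 < N k \<Longrightarrow> k \<in> T"
    and ne: "0 < n k'"
  defines "b \<equiv> \<Sum>k\<in>T. N k - n k"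
  shows "4 \<le> b" and "8 * (\<Sum>k\<in>T. n k) \<le> (b - 2)\<^sup>2 + 4"
proof -
  define S where "S = {k. 0 < n k}"
  have ST: "S \<subseteq> T" using le supp by (force simp: S_def intro: less_le_trans)
  have finS: "finite S" using ST fin finite_subset by blast
  have S_ne: "S \<noteq> {}" using ne by (auto simp: S_def)
  define M where "M = Max (n ` S)"
  have nM: "n k \<le> M" for k
  proof (cases "k \<in> S")
    case True thus ?thesis using finS by (simp add: M_def)
  next
    case False
    have "n k' \<le> M" using finS ne by (simp add: M_def S_def)
    thus ?thesis using False ne by (simp add: S_def)
  qed
  have M_pos: "0 < M" using nM[of k'] ne by simp
  \<comment> \<open>If two consecutive values are maximal, the walk has to start at such a pair to profit from it.\<close>
  have "\<exists>k0. n k0 = M \<and> ((\<exists>k. n k = M \<and> n (k + 1) = M) \<longrightarrow> n (k0 + 1) = M)"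
  proof -
    have "M \<in> n ` S" unfolding M_def using finS S_ne by (intro Max_in) auto
    thus ?thesis by blast
  qed
  then obtain k0 where k0: "n k0 = M"
    and twin: "\<And>k. n k = M \<Longrightarrow> n (k + 1) = M \<Longrightarrow> n (k0 + 1) = M" by blast
  define L where "L = int (card S)"
  define gapR where "gapR \<longleftrightarrow> (\<exists>k>k0. 0 < n k \<and> n (k - 1) = 0)"
  define gapL where "gapL \<longleftrightarrow> (\<exists>k<k0. 0 < n k \<and> n (k + 1) = 0)"
  have right: "M + int (card {k. 0 < n k \<and> k0 \<le> k}) + (if gapR then 1 else 0)
                 \<le> (\<Sum>k \<in> {k\<in>T. k0 < k}. N k - n k)"
    using outward_boundary[of T n N k0] fin nonneg le up supp k0 M_pos
    by (simp add: gapR_def)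
  have left: "M + int (card {k. 0 < n k \<and> k \<le> k0}) + (if gapL then 1 else 0)
                 \<le> (\<Sum>k \<in> {k\<in>T. k < k0}. N k - n k)"
  proof -
    have "n (- (- k0)) + int (card {k. 0 < n (- k) \<and> - k0 \<le> k})
           + (if \<exists>k>- k0. 0 < n (- k) \<and> n (- (k - 1)) = 0 then 1 else 0)
         \<le> (\<Sum>k \<in> {k\<in>uminus ` T. - k0 < k}. N (- k) - n (- k))"
    proof (rule outward_boundary[where n = "\<lambda>k. n (- k)" and N = "\<lambda>k. N (- k)"])
      show "n (- (k - 1)) + 1 \<le> N (- k)" if "0 < n (- (k - 1))" for k
        using down[of "- k"] that by simp
      show "k \<in> uminus ` T" if "0 < N (- k)" for k
        using supp[OF that] by force
    qed (use fin nonneg le k0 M_pos in auto)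
    moreover have "{k. 0 < n (- k) \<and> - k0 \<le> k} = uminus ` {k. 0 < n k \<and> k \<le> k0}"
      by (auto simp: image_iff) (metis add.inverse_inverse neg_le_iff_le minus_le_iff)
    moreover have "(\<exists>k>- k0. 0 < n (- k) \<and> n (- (k - 1)) = 0) \<longleftrightarrow> gapL"
    proof -
      have "(\<exists>k>- k0. 0 < n (- k) \<and> n (- (k - 1)) = 0)
        \<longleftrightarrow> (\<exists>k. - k > - k0 \<and> 0 < n (- (- k)) \<and> n (- (- k - 1)) = 0)"
        by (metis add.inverse_inverse)
      thus ?thesis by (simp add: gapL_def add.commute)
    qed
    moreover have "{k\<in>uminus ` T. - k0 < k} = uminus ` {k\<in>T. k < k0}" by auto
    ultimately show ?thesis using k0 by (simp add: card_image sum.reindex)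
  qed
  define pr where "pr \<longleftrightarrow> n (k0 + 1) = M"
  have mid: "(if pr then 1 else 0) \<le> N k0 - n k0"
    using down[of k0] le[of k0] k0 M_pos by (auto simp: pr_def)
  have split_b: "b = (\<Sum>k \<in> {k\<in>T. k0 < k}. N k - n k) + (N k0 - n k0)
                    + (\<Sum>k \<in> {k\<in>T. k < k0}. N k - n k)"
  proof -
    have "k0 \<in> T" using k0 M_pos ST by (auto simp: S_def)
    then have T: "T = {k\<in>T. k0 < k} \<union> insert k0 {k\<in>T. k < k0}" by auto
    show ?thesis unfolding b_def
      by (subst T, subst sum.union_disjoint) (use fin in auto)
  qed
  have L: "int (card {k. 0 < n k \<and> k0 \<le> k}) + int (card {k. 0 < n k \<and> k \<le> k0}) = L + 1"
  proof -
    have e: "{k. 0 < n k \<and> k0 \<le> k} \<union> {k. 0 < n k \<and> k \<le> k0} = S"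
      "{k. 0 < n k \<and> k0 \<le> k} \<inter> {k. 0 < n k \<and> k \<le> k0} = {k0}"
      using k0 M_pos by (auto simp: S_def)
    have "finite {k. 0 < n k \<and> k0 \<le> k}" "finite {k. 0 < n k \<and> k \<le> k0}"
      by (rule finite_subset[OF _ finS]; auto simp: S_def)+
    from card_Un_Int[OF this] show ?thesis unfolding e L_def by simp
  qed
  have b_ge: "2 * M + L + 1 + (if gapR then 1 else 0) + (if gapL then 1 else 0)
      + (if pr then 1 else 0) \<le> b"
    using right left mid split_b L by linarith
  have L_pos: "1 \<le> L" using S_ne finS by (simp add: L_def Suc_leI card_gt_0_iff)
  show "4 \<le> b" using b_ge M_pos L_pos by (auto split: if_splits)
  have sumT: "(\<Sum>k\<in>T. n k) = (\<Sum>k\<in>S. n k)"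
    by (rule sum.mono_neutral_right[OF fin ST]) (use nonneg in \<open>force simp: S_def order_less_le\<close>)
  show "8 * (\<Sum>k\<in>T. n k) \<le> (b - 2)\<^sup>2 + 4"
  proof (cases "gapR \<or> gapL \<or> pr")
    case True
    hence "2 * M + L \<le> b - 2" using b_ge by (auto split: if_splits)
    hence "(2 * M + L)\<^sup>2 \<le> (b - 2)\<^sup>2" using M_pos L_pos by (intro power_mono) auto
    moreover have "(\<Sum>k\<in>S. n k) \<le> L * M" using sum_bounded_above[of S n M] nM by (simp add: L_def)
    moreover have "(2 * M + L)\<^sup>2 = 8 * (L * M) + (2 * M - L)\<^sup>2" by algebra
    ultimately show ?thesis using sumT zero_le_power2[of "2 * M - L"] by linarith
  next
    case False
    have k0S: "k0 \<in> S" using k0 M_pos by (simp add: S_def)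
    have SI: "S = {Min S..Max S}"
    proof
      show "S \<subseteq> {Min S..Max S}" using finS by auto
      show "{Min S..Max S} \<subseteq> S"
      proof
        fix k assume k: "k \<in> {Min S..Max S}"
        show "k \<in> S"
        proof (cases "k0 \<le> k")
          case True
          have "k \<le> Max S" using k by simp
          thus ?thesis using True
          proof (induction rule: int_le_induct)
            case base show ?case using finS S_ne by simp
          next
            case (step i)
            have "n (i - 1) \<noteq> 0"
              using step False by (auto simp: gapR_def S_def)
            thus ?case using nonneg[of "i - 1"] by (simp add: S_def)
          qed
        next
          case *: False
          have "Min S \<le> k" "k \<le> k0" using k * by auto
          thus ?thesis
          proof (induction rule: int_ge_induct)
            case base show ?case using finS S_ne by simp
          next
            case (step i)
            have "n (i + 1) \<noteq> 0"
              using step False by (auto simp: gapL_def S_def)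
            thus ?case using nonneg[of "i + 1"] by (simp add: S_def)
          qed
        qed
      qed
    qed
    define l where "l = Min S"
    define m where "m = Max S"
    have lm: "l \<le> m" and Slm: "S = {l..m}"
      using SI finS S_ne by (auto simp: l_def m_def)
    have Lm: "L = m - l + 1" using Slm lm by (simp add: L_def)
    have pair: "n (k - 1) + n k \<le> 2 * M - 1" for k
      using nM[of k] nM[of "k - 1"] twin[of "k - 1"] False by (force simp: pr_def)
    have "(\<Sum>k\<in>{l+1..m}. n (k - 1) + n k) \<le> int (card {l+1..m}) * (2 * M - 1)"
      using sum_bounded_above[of "{l+1..m}" "\<lambda>k. n (k - 1) + n k" "2 * M - 1"] pair by simp
    also have "int (card {l+1..m}) = L - 1" using lm Lm by simp
    finally have 1: "(\<Sum>k\<in>{l+1..m}. n (k - 1) + n k) \<le> (L - 1) * (2 * M - 1)" .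
    have "(\<Sum>k\<in>{l+1..m}. n (k - 1)) = (\<Sum>k\<in>{l..m-1}. n k)"
      by (rule sum.reindex_bij_witness[of _ "\<lambda>k. k + 1" "\<lambda>k. k - 1"]) auto
    moreover have "{l..m} = insert l {l+1..m}" "{l..m} = insert m {l..m-1}" using lm by auto
    hence "(\<Sum>k\<in>S. n k) = n l + (\<Sum>k\<in>{l+1..m}. n k)" "(\<Sum>k\<in>S. n k) = n m + (\<Sum>k\<in>{l..m-1}. n k)"
      unfolding Slm by (metis sum.insert finite_atLeastAtMost_int atLeastAtMost_iff add_le_same_cancel1 not_one_le_zero,
        metis sum.insert finite_atLeastAtMost_int atLeastAtMost_iff le_diff_eq add_le_same_cancel1 not_one_le_zero)
    ultimately have 2: "2 * (\<Sum>k\<in>S. n k) \<le> 2 * M + (L - 1) * (2 * M - 1)"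
      using 1 nM[of l] nM[of m] by (simp add: sum.distrib)
    have "8 * (\<Sum>k\<in>S. n k) \<le> 4 * (2 * M + (L - 1) * (2 * M - 1))"
      using mult_left_mono[OF 2, of 4] by simp
    also have "\<dots> = (2 * M - 1 + L)\<^sup>2 + 4 - (2 * M - 1 - L)\<^sup>2" by algebra
    also have "\<dots> \<le> (2 * M - 1 + L)\<^sup>2 + 4" by simp
    also have "(2 * M - 1 + L)\<^sup>2 \<le> (b - 2)\<^sup>2"
      using b_ge M_pos L_pos by (intro power_mono) (auto split: if_splits)
    finally show ?thesis using sumT by simp
  qed
qed

section \<open>The vertex-isoperimetric inequality in the lattice\<close>

definition closed_nbhd :: "Z2 set \<Rightarrow> Z2 set" where
  "closed_nbhd A = {z. \<exists>w\<in>A. z = w \<or> adj w z}"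

lemma adj_iff: "adj v w \<longleftrightarrow> w \<in> {v + (1, 0), v + (-1, 0), v + (0, 1), v + (0, -1)}"
proof -
  obtain a b c d where [simp]: "v = (a, b)" "w = (c, d)" by (metis surj_pair)
  have "\<bar>a - c\<bar> + \<bar>b - d\<bar> = 1 \<longleftrightarrow>
    c = a + 1 \<and> d = b \<or> c = a - 1 \<and> d = b \<or> c = a \<and> d = b + 1 \<or> c = a \<and> d = b - 1"
    by presburger
  thus ?thesis by (simp add: adj_def l1_norm_def)
qed

lemma adj_sym: "adj v w \<longleftrightarrow> adj w v"
  by (simp add: adj_def l1_norm_def abs_minus_commute)

lemma nbhd_single: "closed_nbhd {v} = {v, v + (1, 0), v + (-1, 0), v + (0, 1), v + (0, -1)}"
  by (auto simp: closed_nbhd_def adj_iff)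

lemma nbhd_UN: "closed_nbhd A = (\<Union>v\<in>A. closed_nbhd {v})"
  by (auto simp: closed_nbhd_def)

lemma nbhd_sym: "w \<in> closed_nbhd {v} \<longleftrightarrow> v \<in> closed_nbhd {w}"
  using adj_sym by (auto simp: closed_nbhd_def)

lemma finite_nbhd: "finite A \<Longrightarrow> finite (closed_nbhd A)"
  by (subst nbhd_UN) (simp add: nbhd_single)

lemma subset_nbhd: "A \<subseteq> closed_nbhd A"
  by (auto simp: closed_nbhd_def)

lemma nbhd_step:
  assumes "v \<in> A"
  shows "v + (1, 0) \<in> closed_nbhd A" "v + (-1, 0) \<in> closed_nbhd A"
    "v + (0, 1) \<in> closed_nbhd A" "v + (0, -1) \<in> closed_nbhd A"
  using assms by (subst nbhd_UN, force simp: nbhd_single)+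

definition antidiag :: "Z2 set \<Rightarrow> int \<Rightarrow> Z2 set" where
  "antidiag A k = {v \<in> A. fst v + snd v = k}"

text \<open>
  The translate by \<open>c\<close> of the extreme point in the direction of \<open>c - a\<close> does not belong to the
  translate of the slice by \<open>a\<close>.
\<close>

lemma card_antidiag_translates:
  assumes fin: "finite (antidiag A k)" and ne: "antidiag A k \<noteq> {}" and B: "finite B"
    and c: "c = a + (1, -1)"
    and sub: "\<And>v. v \<in> antidiag A k \<Longrightarrow> v + a \<in> B" "\<And>v. v \<in> antidiag A k \<Longrightarrow> v + c \<in> B"
  shows "card (antidiag A k) + 1 \<le> card B"
proof -
  obtain v where v: "v \<in> antidiag A k" "\<And>w. w \<in> antidiag A k \<Longrightarrow> fst w \<le> fst v"
    using ne fin Max_in[of "fst ` antidiag A k"] Max_ge[of "fst ` antidiag A k"]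
    by (metis (no_types, lifting) finite_imageI imageE image_eqI image_is_empty)
  have new: "v + c \<notin> (\<lambda>v. v + a) ` antidiag A k"
    using v(2) c by (fastforce simp: prod_eq_iff)
  have "card (antidiag A k) + 1 = card (insert (v + c) ((\<lambda>v. v + a) ` antidiag A k))"
    using new fin by (simp add: card_image)
  also have "\<dots> \<le> card B" by (rule card_mono[OF B]) (use sub v(1) in auto)
  finally show ?thesis .
qed

lemma card_eq_sum_antidiag:
  assumes "finite A" "finite T" "\<And>v. v \<in> A \<Longrightarrow> fst v + snd v \<in> T"
  shows "card A = (\<Sum>k\<in>T. card (antidiag A k))"
proof -
  have "A = (\<Union>k\<in>T. antidiag A k)" using assms(3) by (auto simp: antidiag_def)
  thus ?thesis
    using card_UN_disjoint[of T "antidiag A"] assms(1,2) by (auto simp: antidiag_def)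
qed

text \<open>
  The points of \<open>A\<close> on the line $x + y = k - 1$ have neighbours on the line $x + y = k$ that fill
  two different translates, and likewise for the line $x + y = k + 1$; so the cardinalities of
  the slices satisfy the hypotheses of \<open>profile_isoperimetric\<close>.
\<close>

proposition vertex_isoperimetric:
  assumes fin: "finite A" and ne: "A \<noteq> {}"
  defines "b \<equiv> int (card (closed_nbhd A)) - int (card A)"
  shows "4 \<le> b" and "8 * int (card A) \<le> (b - 2)\<^sup>2 + 4"
proof -
  define n where "n k = int (card (antidiag A k))" for k
  define N where "N k = int (card (antidiag (closed_nbhd A) k))" for k
  define T where "T = (\<lambda>v. fst v + snd v) ` closed_nbhd A"
  have finN: "finite (closed_nbhd A)" using fin by (rule finite_nbhd)
  have finA[simp]: "finite (antidiag A k)" "finite (antidiag (closed_nbhd A) k)" for k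
    using fin finN by (auto simp: antidiag_def)
  have finT: "finite T" using finN by (simp add: T_def)
  have le: "n k \<le> N k" for k
    unfolding n_def N_def using subset_nbhd[of A]
    by (simp, intro card_mono finA) (auto simp: antidiag_def)
  have up: "n (k - 1) + 1 \<le> N k" if "0 < n (k - 1)" for k
  proof -
    have "card (antidiag A (k - 1)) + 1 \<le> card (antidiag (closed_nbhd A) k)"
    proof (rule card_antidiag_translates[where a = "(0, 1)" and c = "(1, 0)"])
      show "antidiag A (k - 1) \<noteq> {}" using that by (auto simp: n_def)
      show "v + (0, 1) \<in> antidiag (closed_nbhd A) k" "v + (1, 0) \<in> antidiag (closed_nbhd A) k"
        if "v \<in> antidiag A (k - 1)" for v
        using that nbhd_step[of v A] by (auto simp: antidiag_def)
    qed simp_all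
    thus ?thesis by (simp add: n_def N_def)
  qed
  have down: "n (k + 1) + 1 \<le> N k" if "0 < n (k + 1)" for k
  proof -
    have "card (antidiag A (k + 1)) + 1 \<le> card (antidiag (closed_nbhd A) k)"
    proof (rule card_antidiag_translates[where a = "(-1, 0)" and c = "(0, -1)"])
      show "antidiag A (k + 1) \<noteq> {}" using that by (auto simp: n_def)
      show "v + (-1, 0) \<in> antidiag (closed_nbhd A) k" "v + (0, -1) \<in> antidiag (closed_nbhd A) k"
        if "v \<in> antidiag A (k + 1)" for v
        using that nbhd_step[of v A] by (auto simp: antidiag_def)
    qed simp_all
    thus ?thesis by (simp add: n_def N_def)
  qed
  have supp: "k \<in> T" if "0 < N k" for k
  proof -
    have "antidiag (closed_nbhd A) k \<noteq> {}" using that by (auto simp: N_def)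
    thus ?thesis unfolding T_def antidiag_def by blast
  qed
  obtain v where "v \<in> A" using ne by blast
  hence "v \<in> antidiag A (fst v + snd v)" by (simp add: antidiag_def)
  hence ne': "0 < n (fst v + snd v)" by (auto simp: n_def card_gt_0_iff)
  have cA: "int (card A) = (\<Sum>k\<in>T. n k)"
  proof -
    have "fst v + snd v \<in> T" if "v \<in> A" for v
      using that subset_nbhd unfolding T_def by blast
    thus ?thesis using card_eq_sum_antidiag[OF fin finT] by (simp add: n_def)
  qed
  have cN: "int (card (closed_nbhd A)) = (\<Sum>k\<in>T. N k)"
    using card_eq_sum_antidiag[OF finN finT] by (simp add: N_def T_def)
  have b: "b = (\<Sum>k\<in>T. N k - n k)" by (simp add: b_def cA cN sum_subtractf)
  have nonneg: "0 \<le> n k" for k by (simp add: n_def)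
  note profile = profile_isoperimetric[where n = n and N = N, OF finT nonneg le up down supp ne']
  show "4 \<le> b" and "8 * int (card A) \<le> (b - 2)\<^sup>2 + 4"
    using profile by (simp_all add: b cA)
qed

section \<open>Initial segments of the Wang-Wang order\<close>

definition ww_le :: "Z2 \<Rightarrow> Z2 \<Rightarrow> bool" where
  "ww_le v w \<longleftrightarrow> \<not> ww_less w v"

definition segment :: "Z2 \<Rightarrow> Z2 set" where
  "segment v = {w. ww_le w v}"

text \<open>The neighbour of \<open>v\<close> that comes last in the order; see \<open>ww_le_last_nbr\<close> below.\<close>

definition last_nbr :: "Z2 \<Rightarrow> Z2" where
  "last_nbr v = (if 1 \<le> snd v then v + (0, 1) else v + (0, -1))"

text \<open>
  The position of \<open>v\<close> in the order, starting from 1 (\<open>int_card_segment\<close>). In the layer of norm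
  $r \ge 1$ the four groups have $r - 1$, $r$, $r$ and $r + 1$ points, and there are
  $2r^2 - 2r + 1$ points of smaller norm.
\<close>

definition ww_rank :: "Z2 \<Rightarrow> int" where
  "ww_rank v = (let r = l1_norm v in
     if 1 \<le> snd v then (if 1 \<le> fst v then 2 * r\<^sup>2 - 2 * r + 1 else 2 * r\<^sup>2 - r) + snd v
     else (if 1 \<le> fst v then 2 * r\<^sup>2 else 2 * r\<^sup>2 + r) + 1 - snd v)"

lemma ww_le_iff: "ww_le v w \<longleftrightarrow> ww_less v w \<or> v = w"
  using ww_less_total ww_less_trans ww_less_irrefl unfolding ww_le_def by metis

lemma ww_le_trans: "ww_le u v \<Longrightarrow> ww_le v w \<Longrightarrow> ww_le u w"
  using ww_less_trans unfolding ww_le_iff by metis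

lemma segment_eq: "segment v = insert v {w. ww_less w v}"
  by (auto simp: segment_def ww_le_iff)

lemma finite_segment: "finite (segment v)"
  by (simp add: segment_eq finite_ww_less)

lemma card_segment: "card (segment v) = Suc (card {w. ww_less w v})"
  by (simp add: segment_eq finite_ww_less ww_less_irrefl)

lemma l1_norm_ge: "\<bar>snd v\<bar> \<le> l1_norm v" "l1_norm v = 0 \<longleftrightarrow> v = 0"
  by (auto simp: l1_norm_def prod_eq_iff)

lemma ww_rank_le: "ww_rank v \<le> 2 * (l1_norm v)\<^sup>2 + 2 * l1_norm v + 1"
  using l1_norm_ge(1)[of v] by (auto simp: ww_rank_def Let_def)

lemma ww_rank_greater:
  assumes "v \<noteq> 0"
  shows "2 * (l1_norm v)\<^sup>2 - 2 * l1_norm v + 1 < ww_rank v"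
  using l1_norm_ge[of v] assms by (auto simp: ww_rank_def Let_def)

lemma ww_rank_pos: "1 \<le> ww_rank v"
proof (cases "v = 0")
  case False
  have "0 \<le> l1_norm v * (l1_norm v - 1)"
    using False l1_norm_ge[of v] by (intro mult_nonneg_nonneg) auto
  thus ?thesis using ww_rank_greater[OF False] by (simp add: power2_eq_square algebra_simps)
qed (simp add: ww_rank_def l1_norm_def)

lemma ww_rank_strict_mono:
  assumes "ww_less v w"
  shows "ww_rank v < ww_rank w"
proof (cases "l1_norm v < l1_norm w")
  case True
  have "0 \<le> l1_norm v" by (simp add: l1_norm_def)
  hence "(l1_norm v + 1) * l1_norm v \<le> l1_norm w * (l1_norm w - 1)"
    using True by (intro mult_mono) auto
  hence "2 * (l1_norm v)\<^sup>2 + 2 * l1_norm v + 1 \<le> 2 * (l1_norm w)\<^sup>2 - 2 * l1_norm w + 1"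
    by (simp add: power2_eq_square algebra_simps)
  moreover have "w \<noteq> 0" using True \<open>0 \<le> l1_norm v\<close> by (auto simp: l1_norm_def)
  ultimately show ?thesis using ww_rank_greater[of w] ww_rank_le[of v] by simp
next
  case False
  hence eq: "l1_norm v = l1_norm w" and
    "ww_group v < ww_group w \<or> ww_group v = ww_group w \<and> \<bar>snd v\<bar> < \<bar>snd w\<bar>"
    using assms by (auto simp: ww_less_def)
  moreover have "\<bar>snd v\<bar> + \<bar>fst v\<bar> = l1_norm w" "\<bar>snd w\<bar> + \<bar>fst w\<bar> = l1_norm w"
    using eq by (auto simp: l1_norm_def)
  ultimately show ?thesis
    by (simp add: ww_rank_def ww_group_def Let_def eq split: if_splits)
qed

text \<open>
  Given a position, first the layer is determined and then the group in it; the
  coordinate $y$ is read off from the offset within the group.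
\<close>

lemma ww_rank_surj:
  assumes "1 \<le> n"
  shows "\<exists>v. ww_rank v = n"
proof (cases "n = 1")
  case True
  thus ?thesis by (intro exI[of _ 0]) (simp add: ww_rank_def l1_norm_def)
next
  case False
  define r where "r = (LEAST r :: nat. n \<le> 2 * (int r)\<^sup>2 + 2 * int r + 1)"
  have "n \<le> 2 * (int (nat n))\<^sup>2 + 2 * int (nat n) + 1"
    using assms zero_le_power2[of n] by simp
  hence hi: "n \<le> 2 * (int r)\<^sup>2 + 2 * int r + 1" unfolding r_def by (rule LeastI)
  have "r \<noteq> 0" using hi False assms by (cases "r = 0") auto
  then obtain q where q: "r = Suc q" by (cases r) auto
  have "\<not> n \<le> 2 * (int q)\<^sup>2 + 2 * int q + 1"
    by (rule not_less_Least) (simp add: r_def[symmetric] q)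
  define R where "R = int r"
  have "(int q)\<^sup>2 = R\<^sup>2 - 2 * R + 1" by (simp add: R_def q power2_eq_square algebra_simps)
  hence lo: "2 * R\<^sup>2 - 2 * R + 1 < n" and hi: "n \<le> 2 * R\<^sup>2 + 2 * R + 1" and R: "1 \<le> R"
    using \<open>\<not> n \<le> _\<close> hi by (auto simp: R_def q)
  consider "n \<le> 2 * R\<^sup>2 - R" | "2 * R\<^sup>2 - R < n" "n \<le> 2 * R\<^sup>2"
    | "2 * R\<^sup>2 < n" "n \<le> 2 * R\<^sup>2 + R" | "2 * R\<^sup>2 + R < n" by linarith
  thus ?thesis
  proof cases
    case 1
    define y where "y = n - (2 * R\<^sup>2 - 2 * R + 1)"
    have "l1_norm (R - y, y) = R" "1 \<le> y" "1 \<le> R - y"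
      using 1 lo by (auto simp: l1_norm_def y_def)
    thus ?thesis by (intro exI[of _ "(R - y, y)"]) (simp add: ww_rank_def Let_def y_def)
  next
    case 2
    define y where "y = n - (2 * R\<^sup>2 - R)"
    have "l1_norm (y - R, y) = R" "1 \<le> y" "y \<le> R"
      using 2 by (auto simp: l1_norm_def y_def)
    thus ?thesis by (intro exI[of _ "(y - R, y)"]) (simp add: ww_rank_def Let_def y_def)
  next
    case 3
    define y where "y = 2 * R\<^sup>2 + 1 - n"
    have "l1_norm (R + y, y) = R" "y \<le> 0" "1 \<le> R + y"
      using 3 by (auto simp: l1_norm_def y_def)
    thus ?thesis by (intro exI[of _ "(R + y, y)"]) (simp add: ww_rank_def Let_def y_def)
  next
    case 4
    define y where "y = 2 * R\<^sup>2 + R + 1 - n"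
    have "l1_norm (- R - y, y) = R" "y \<le> 0" "- R - y \<le> 0"
      using 4 hi by (auto simp: l1_norm_def y_def)
    thus ?thesis by (intro exI[of _ "(- R - y, y)"]) (simp add: ww_rank_def Let_def y_def)
  qed
qed

lemma int_card_segment: "int (card (segment v)) = ww_rank v"
proof -
  have less_iff: "ww_rank w \<le> ww_rank v \<longleftrightarrow> ww_le w v" for w v
    using ww_rank_strict_mono ww_less_total unfolding ww_le_iff
    by (metis less_imp_le linorder_not_le order_refl)
  have "bij_betw ww_rank (segment v) {1..ww_rank v}"
  proof (rule bij_betw_imageI)
    show "inj_on ww_rank (segment v)"
      by (rule inj_onI) (metis less_irrefl ww_rank_strict_mono ww_less_total)
    show "ww_rank ` segment v = {1..ww_rank v}"
    proof
      show "ww_rank ` segment v \<subseteq> {1..ww_rank v}"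
        using ww_rank_pos less_iff by (simp add: segment_def image_subset_iff)
      show "{1..ww_rank v} \<subseteq> ww_rank ` segment v"
      proof
        fix n assume n: "n \<in> {1..ww_rank v}"
        then obtain w where "ww_rank w = n" using ww_rank_surj by fastforce
        thus "n \<in> ww_rank ` segment v" using n less_iff[of w v] by (auto simp: segment_def)
      qed
    qed
  qed
  hence "card (segment v) = card {1..ww_rank v}" by (rule bij_betw_same_card)
  thus ?thesis using ww_rank_pos[of v] by simp
qed

text \<open>
  The order is determined by these three quantities. As each of them changes by the same amount
  for all points, passing to the last neighbour is compatible with the order.
\<close>

lemma last_nbr_layer:
  "l1_norm (last_nbr v) = l1_norm v + 1"
  "ww_group (last_nbr v) = ww_group v"
  "\<bar>snd (last_nbr v)\<bar> = \<bar>snd v\<bar> + 1"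
  by (simp_all add: last_nbr_def l1_norm_def ww_group_def)

lemma last_nbr_mono:
  assumes "ww_le v w"
  shows "ww_le (last_nbr v) (last_nbr w)"
  using assms unfolding ww_le_def ww_less_def last_nbr_layer by auto

lemma ww_le_last_nbr:
  assumes "z \<in> closed_nbhd {v}"
  shows "ww_le z (last_nbr v)"
proof -
  obtain x y where v: "v = (x, y)" by (metis surj_pair)
  consider "z = (x, y)" | "z = (x + 1, y)" | "z = (x - 1, y)" | "z = (x, y + 1)" | "z = (x, y - 1)"
    using assms by (auto simp: nbhd_single v)
  thus ?thesis
    unfolding ww_le_def ww_less_def last_nbr_layer
    by cases (auto simp: v ww_group_def l1_norm_def abs_if split: if_splits)
qed

text \<open>
  The witness is the first point, in the order, of the closed neighbourhood of \<open>z\<close>. A step towards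
  the horizontal axis is best if it keeps the group, since it lowers $|y|$. From the line $y = 1$
  it would lead to a later group, and on the axis there is none; then the step goes towards the
  vertical axis. The remaining points $(0, 1)$ and $(0, 0)$ get the origin.
\<close>

lemma exists_early_nbr:
  assumes "ww_le z (last_nbr v)"
  shows "\<exists>w. ww_le w v \<and> z \<in> closed_nbhd {w}"
proof -
  obtain x y where z: "z = (x, y)" by (metis surj_pair)
  define w where "w =
    (if 2 \<le> y then (x, y - 1)
     else if y \<le> -1 then (x, y + 1)
     else if 1 \<le> x then (x - 1, y)
     else if x \<le> -1 then (x + 1, y)
     else (0, 0))"
  have "z \<in> closed_nbhd {w}" by (auto simp: nbhd_single z w_def)
  moreover have "ww_le w v"
    using assms
    unfolding ww_le_def ww_less_def last_nbr_layer
    by (auto simp: z w_def ww_group_def l1_norm_def abs_if split: if_splits)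
  ultimately show ?thesis by blast
qed

lemma nbhd_segment: "closed_nbhd (segment v) = segment (last_nbr v)"
proof -
  have "(\<exists>w. ww_le w v \<and> z \<in> closed_nbhd {w}) \<longleftrightarrow> ww_le z (last_nbr v)" for z
    using ww_le_last_nbr last_nbr_mono ww_le_trans exists_early_nbr by meson
  hence "z \<in> (\<Union>w\<in>segment v. closed_nbhd {w}) \<longleftrightarrow> z \<in> segment (last_nbr v)" for z
    unfolding segment_def by blast
  thus ?thesis using nbhd_UN[of "segment v"] by blast
qed

lemma ww_rank_last_nbr: "ww_rank (last_nbr v) = ww_rank v + 4 * l1_norm v + int (ww_group v)"
proof -
  have "fst (last_nbr v) = fst v" "snd (last_nbr v) = (if 1 \<le> snd v then snd v + 1 else snd v - 1)"
    by (simp_all add: last_nbr_def)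
  thus ?thesis
    by (simp add: ww_rank_def last_nbr_layer(1) ww_group_def Let_def power2_eq_square algebra_simps)
qed

text \<open>
  With one adjacent vertex fewer than the segment of \<open>v\<close> has, the isoperimetric inequality would
  fail for a set of this size.
\<close>

lemma boundary_segment_minimal:
  "(ww_rank (last_nbr v) - ww_rank v - 3)\<^sup>2 + 4 < 8 * ww_rank v"
  unfolding ww_rank_last_nbr using l1_norm_ge(1)[of v]
  by (simp add: ww_rank_def ww_group_def Let_def power2_eq_square algebra_simps)

theorem ww_segments_optimal:
  assumes fin: "finite A" and card: "card A = card (segment v)"
  shows "card (closed_nbhd (segment v)) \<le> card (closed_nbhd A)"
proof (rule ccontr)
  assume *: "\<not> card (closed_nbhd (segment v)) \<le> card (closed_nbhd A)"
  define b where "b = int (card (closed_nbhd A)) - int (card A)"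
  define c where "c = ww_rank (last_nbr v) - ww_rank v"
  have "b < c"
    using * card int_card_segment[of v] int_card_segment[of "last_nbr v"]
    by (simp add: b_def c_def nbhd_segment)
  have "A \<noteq> {}" using card by (auto simp: card_segment)
  from vertex_isoperimetric[OF fin this] have "4 \<le> b" "8 * int (card A) \<le> (b - 2)\<^sup>2 + 4"
    by (simp_all add: b_def)
  moreover have "(b - 2)\<^sup>2 \<le> (c - 3)\<^sup>2"
    using \<open>4 \<le> b\<close> \<open>b < c\<close> by (intro power_mono) auto
  moreover have "(c - 3)\<^sup>2 + 4 < 8 * int (card A)"
    using boundary_segment_minimal[of v] card int_card_segment[of v] by (simp add: c_def)
  ultimately show False by linarith
qed

section \<open>Level sets of the rearrangement\<close>

text \<open>From here on points of the lattice are treated as atoms and not split into coordinates.\<close>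

declare split_paired_All [simp del] split_paired_Ex [simp del] split_paired_all [simp del]

lemma card_segment_le_iff: "card (segment v) \<le> card (segment w) \<longleftrightarrow> ww_le v w"
  using card_ww_less_mono[of v w] card_ww_less_mono[of w v] ww_less_total[of v w]
  unfolding card_segment ww_le_def by (metis Suc_le_mono less_le_not_le order_refl)

lemma ww_labelling_card_segment: "ww_labelling (card (segment v)) = v"
  by (simp add: ww_labelling_eq_iff card_segment)

lemma card_segment_ww_labelling: "1 \<le> k \<Longrightarrow> card (segment (ww_labelling k)) = k"
  by (simp add: card_segment card_ww_labelling)

lemma ww_rearrangement_eq: "ww_rearrangement f v = kth_largest f (card (segment v))"
proof -
  have "inv_into {1..} ww_labelling v = card (segment v)"
    using bij_betw_ww_labelling ww_labelling_card_segment[of v]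
    by (intro inv_into_f_eq) (simp_all add: bij_betw_def card_segment)
  thus ?thesis by (simp add: ww_rearrangement_def rearrangement_def)
qed

context
  fixes f :: "Z2 \<Rightarrow> real"
  assumes van: "vanishes_at_infinity f"
begin

lemma finite_superlevel: "0 < t \<Longrightarrow> finite {x. t < \<bar>f x\<bar>}"
  using van by (simp add: vanishes_at_infinity_def)

lemma kth_largest_nonneg: "1 \<le> k \<Longrightarrow> 0 \<le> kth_largest f k"
  using kth_largest_greatest(1)[OF van] by blast

lemma le_kth_largest:
  assumes "1 \<le> k" "finite B" "k \<le> card B" "0 \<le> t" "\<And>x. x \<in> B \<Longrightarrow> t \<le> \<bar>f x\<bar>"
  shows "t \<le> kth_largest f k"
proof -
  obtain A where "A \<subseteq> B" "card A = k" "finite A"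
    using assms(3) obtain_subset_with_card_n by metis
  thus ?thesis using assms by (intro kth_largest_greatest(2)[OF van]) blast+
qed

lemma less_kth_largest_iff:
  assumes k: "1 \<le> k" and t: "0 < t"
  shows "t < kth_largest f k \<longleftrightarrow> k \<le> card {x. t < \<bar>f x\<bar>}"
proof
  assume "t < kth_largest f k"
  then obtain A where "card A = k" "\<forall>x\<in>A. t < \<bar>f x\<bar>"
    using kth_largest_greatest(1)[OF van k] by fastforce
  thus "k \<le> card {x. t < \<bar>f x\<bar>}"
    using card_mono[OF finite_superlevel[OF t], of A] by auto
next
  let ?B = "{x. t < \<bar>f x\<bar>}"
  assume kB: "k \<le> card ?B"
  have "card ?B \<noteq> 0" using kB k by linarith
  hence B: "finite ?B" "?B \<noteq> {}" using finite_superlevel[OF t] by (blast, force)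
  define s where "s = Min ((\<lambda>x. \<bar>f x\<bar>) ` ?B)"
  have "s \<in> (\<lambda>x. \<bar>f x\<bar>) ` ?B" unfolding s_def using B by (intro Min_in) auto
  hence "t < s" by auto
  moreover have "s \<le> kth_largest f k"
    using B t \<open>t < s\<close> by (intro le_kth_largest[OF k _ kB]) (auto simp: s_def)
  ultimately show "t < kth_largest f k" by simp
qed

lemma ww_rearrangement_nonneg: "0 \<le> ww_rearrangement f v"
  by (simp add: ww_rearrangement_eq kth_largest_nonneg card_segment)

lemma less_ww_rearrangement_iff:
  "0 < t \<Longrightarrow> t < ww_rearrangement f v \<longleftrightarrow> card (segment v) \<le> card {x. t < \<bar>f x\<bar>}"
  by (simp add: ww_rearrangement_eq less_kth_largest_iff card_segment del: card_eq_0_iff)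

lemma superlevel_ww_rearrangement:
  assumes t: "0 < t"
  obtains (empty) "{x. t < ww_rearrangement f x} = {}" "{x. t < \<bar>f x\<bar>} = {}"
  | (segment) v where "{x. t < ww_rearrangement f x} = segment v"
      "card {x. t < \<bar>f x\<bar>} = card (segment v)"
proof (cases "card {x. t < \<bar>f x\<bar>}")
  case 0
  hence "{x. t < \<bar>f x\<bar>} = {}" using finite_superlevel[OF t] by simp
  moreover have "{x. t < ww_rearrangement f x} = {}"
    using 0 by (simp add: less_ww_rearrangement_iff[OF t] card_segment)
  ultimately show ?thesis by (rule empty[rotated])
next
  case (Suc n)
  define v where "v = ww_labelling (Suc n)"
  have c: "card (segment v) = Suc n" by (simp add: v_def card_segment_ww_labelling)
  show ?thesis
    using Suc c card_segment_le_iff[of _ v]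
    by (intro segment[of v]) (simp_all add: less_ww_rearrangement_iff[OF t] segment_def)
qed

lemma finite_superlevel_ww_rearrangement:
  assumes "0 < t"
  shows "finite {x. t < ww_rearrangement f x}"
  using assms by (cases rule: superlevel_ww_rearrangement) (simp_all add: finite_segment)

lemma ww_rearrangement_antimono:
  assumes "ww_le v w"
  shows "ww_rearrangement f w \<le> ww_rearrangement f v"
proof (rule dense_le)
  fix t assume t: "t < ww_rearrangement f w"
  show "t \<le> ww_rearrangement f v"
  proof (cases "0 < t")
    case True
    have "card (segment v) \<le> card {x. t < \<bar>f x\<bar>}"
      using t assms card_segment_le_iff[of v w] less_ww_rearrangement_iff[OF True, of w] by linarith
    thus ?thesis using less_ww_rearrangement_iff[OF True, of v] by linarith
  qed (use ww_rearrangement_nonneg[of v] in linarith)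
qed

lemma card_nbhd_superlevel:
  assumes t: "0 < t"
  shows "card (closed_nbhd {x. t < ww_rearrangement f x}) \<le> card (closed_nbhd {x. t < \<bar>f x\<bar>})"
  using t
proof (cases rule: superlevel_ww_rearrangement)
  case empty
  show ?thesis unfolding empty ..
next
  case (segment v)
  thus ?thesis using ww_segments_optimal[OF finite_superlevel[OF t]] by simp
qed

text \<open>
  The least value on \<open>B\<close> is at most the $m$-th largest value of all; remove a point where it
  is attained and use induction.
\<close>

lemma sum_kth_largest_le:
  fixes G :: "real \<Rightarrow> ennreal"
  assumes G: "antimono G" and B: "finite B" "m \<le> card B"
  shows "(\<Sum>k=1..m. G (kth_largest f k)) \<le> (\<Sum>x\<in>B. G \<bar>f x\<bar>)"
  using B
proof (induction m arbitrary: B)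
  case 0
  show ?case by simp
next
  case (Suc m)
  define s where "s = Min ((\<lambda>x. \<bar>f x\<bar>) ` B)"
  have "B \<noteq> {}" using Suc.prems by auto
  hence "s \<in> (\<lambda>x. \<bar>f x\<bar>) ` B" unfolding s_def using Suc.prems by (intro Min_in) auto
  then obtain x where x: "x \<in> B" "s = \<bar>f x\<bar>" by blast
  hence "0 \<le> s" by simp
  have "s \<le> kth_largest f (Suc m)"
    using Suc.prems \<open>0 \<le> s\<close> by (intro le_kth_largest[of _ B]) (simp_all add: s_def)
  hence "G (kth_largest f (Suc m)) \<le> G \<bar>f x\<bar>" using antimonoD[OF G] x by simp
  moreover have "(\<Sum>k=1..m. G (kth_largest f k)) \<le> (\<Sum>x\<in>B - {x}. G \<bar>f x\<bar>)"
    using Suc.prems x by (intro Suc.IH) auto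
  ultimately show ?case
    using Suc.prems x by (simp add: sum.remove[of B x] add_mono add.commute)
qed

text \<open>
  On the left the sum runs over an initial segment, hence over the largest values of $|f|$, and it
  has at most as many terms as the sum on the right.
\<close>

lemma sum_nbhd_superlevel_le:
  fixes G :: "real \<Rightarrow> ennreal"
  assumes G: "antimono G" and t: "0 < t"
  shows "(\<Sum>x\<in>closed_nbhd {x. t < ww_rearrangement f x}. G (ww_rearrangement f x))
       \<le> (\<Sum>x\<in>closed_nbhd {x. t < \<bar>f x\<bar>}. G \<bar>f x\<bar>)"
  using t
proof (cases rule: superlevel_ww_rearrangement)
  case empty
  thus ?thesis by (simp add: closed_nbhd_def)
next
  case (segment v)
  define m where "m = card (segment (last_nbr v))"
  have "(\<Sum>x\<in>segment (last_nbr v). G (ww_rearrangement f x)) = (\<Sum>k=1..m. G (kth_largest f k))"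
  proof (rule sum.reindex_bij_witness[of _ ww_labelling "\<lambda>x. card (segment x)"])
    show "card (segment x) \<in> {1..m}" if "x \<in> segment (last_nbr v)" for x
      using that card_segment_le_iff[of x "last_nbr v"] card_segment[of x]
      by (simp add: segment_def[of "last_nbr v"] m_def)
    show "ww_labelling k \<in> segment (last_nbr v)" if "k \<in> {1..m}" for k
      using that card_segment_le_iff[of "ww_labelling k" "last_nbr v"]
      by (simp add: card_segment_ww_labelling m_def segment_def[of "last_nbr v"])
  qed (simp_all add: ww_labelling_card_segment card_segment_ww_labelling ww_rearrangement_eq)
  also have "\<dots> \<le> (\<Sum>x\<in>closed_nbhd {x. t < \<bar>f x\<bar>}. G \<bar>f x\<bar>)"
    using card_nbhd_superlevel[OF t] finite_superlevel[OF t] segment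
    by (intro sum_kth_largest_le[OF G]) (auto simp: finite_nbhd m_def nbhd_segment)
  finally show ?thesis using segment by (simp add: nbhd_segment)
qed

end

section \<open>Peaks and the layer-cake formula\<close>

definition peak :: "(Z2 \<Rightarrow> real) \<Rightarrow> Z2 \<Rightarrow> real" where
  "peak g v = Max (g ` closed_nbhd {v})"

lemma peak_ge: "w \<in> closed_nbhd {v} \<Longrightarrow> g w \<le> peak g v"
  unfolding peak_def by (intro Max_ge) (auto simp: finite_nbhd)

lemma peak_attained: "\<exists>w\<in>closed_nbhd {v}. peak g v = g w"
proof -
  have "peak g v \<in> g ` closed_nbhd {v}"
    unfolding peak_def using subset_nbhd[of "{v}"] by (intro Max_in) (auto simp: finite_nbhd)
  thus ?thesis by blast
qed

lemma peak_ge_self: "g v \<le> peak g v"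
  using subset_nbhd[of "{v}"] by (intro peak_ge) auto

lemma less_peak_iff: "t < peak g v \<longleftrightarrow> v \<in> closed_nbhd {x. t < g x}"
proof -
  have "v \<in> closed_nbhd {x. t < g x} \<longleftrightarrow> (\<exists>w\<in>closed_nbhd {v}. t < g w)"
    by (subst nbhd_UN) (auto simp: nbhd_sym[of v])
  thus ?thesis using peak_ge[of _ v g] peak_attained[of v g] by (metis less_le_trans)
qed

text \<open>
  The derivative of $(u - c)_+^p$ with respect to $u$. It vanishes for $u \le c$ also if $p = 1$,
  because \<open>0 powr 0 = 0\<close>.
\<close>

definition pos_powr_deriv :: "real \<Rightarrow> real \<Rightarrow> real \<Rightarrow> ennreal" where
  "pos_powr_deriv p u c = ennreal (p * max 0 (u - c) powr (p - 1))"

lemma antimono_pos_powr_deriv: "1 \<le> p \<Longrightarrow> antimono (pos_powr_deriv p u)"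
  unfolding pos_powr_deriv_def
  by (intro antimonoI ennreal_leI mult_left_mono powr_mono2) auto

lemma powr_layer_cake:
  assumes p: "1 \<le> p" and c: "0 \<le> c" "c \<le> b"
  shows "(\<integral>\<^sup>+u. pos_powr_deriv p u c * indicator {0<..<b} u \<partial>lborel) = ennreal ((b - c) powr p)"
proof -
  define d where "d = b - c"
  have [measurable]: "(\<lambda>u. pos_powr_deriv p u c) \<in> borel_measurable lborel"
    unfolding pos_powr_deriv_def by measurable
  have "(\<integral>\<^sup>+u. pos_powr_deriv p u c * indicator {0<..<b} u \<partial>lborel)
      = (\<integral>\<^sup>+x. pos_powr_deriv p (c + x) c * indicator {0<..<b} (c + x) \<partial>lborel)"
    using nn_integral_real_affine[of "\<lambda>u. pos_powr_deriv p u c * indicator {0<..<b} u" 1 c] by simp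
  \<comment> \<open>The integrands differ at the right end point at most.\<close>
  also have "\<dots> = (\<integral>\<^sup>+x. ennreal (indicator {0..d} x * (p * x powr (p - 1))) \<partial>lborel)"
  proof (rule nn_integral_cong_AE)
    have "AE x in lborel. x \<noteq> d" by (rule AE_lborel_singleton)
    thus "AE x in lborel. pos_powr_deriv p (c + x) c * indicator {0<..<b} (c + x)
        = ennreal (indicator {0..d} x * (p * x powr (p - 1)))"
    proof eventually_elim
      case (elim x)
      show ?case
        using elim c by (cases "x = 0") (auto simp: pos_powr_deriv_def indicator_def d_def max_def)
    qed
  qed
  also have "\<dots> = ennreal (d powr p)"
  proof (rule nn_integral_has_integral_lborel)
    have "((\<lambda>x. p * x powr (p - 1)) has_integral p * (d powr (p - 1 + 1) / (p - 1 + 1))) {0..d}"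
      using p c by (intro has_integral_mult_right has_integral_powr_from_0) (auto simp: d_def)
    hence "((\<lambda>x. p * x powr (p - 1)) has_integral d powr p) {0..d}"
      using p by simp
    moreover have "(\<lambda>x. indicator {0..d} x * (p * x powr (p - 1)))
        = (\<lambda>x. if x \<in> {0..d} then p * x powr (p - 1) else 0)"
      by (auto simp: fun_eq_iff indicator_def)
    ultimately show "((\<lambda>x. indicator {0..d} x * (p * x powr (p - 1))) has_integral d powr p) UNIV"
      by (simp only: has_integral_restrict_UNIV)
  qed (use p in auto)
  finally show ?thesis by (simp add: d_def)
qed

lemma nn_integral_count_space_eq_infsum:
  fixes f :: "'a \<Rightarrow> ennreal"
  assumes "countable A"
  shows "(\<integral>\<^sup>+x. f x \<partial>count_space A) = (\<Sum>\<^sub>\<infinity>x\<in>A. f x)"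
proof (cases "finite A")
  case True
  thus ?thesis by (simp add: nn_integral_count_space_finite)
next
  case False
  let ?e = "from_nat_into A"
  have bij: "bij_betw ?e UNIV A" using bij_betw_from_nat_into[OF assms False] .
  have "(\<integral>\<^sup>+x. f x \<partial>count_space A) = (\<Sum>n. f (?e n))"
    by (simp add: nn_integral_bij_count_space[OF bij, symmetric] nn_integral_count_space_nat)
  also have "\<dots> = (\<Sum>\<^sub>\<infinity>n. f (?e n))"
  proof -
    have "(\<lambda>n. f (?e n)) sums (\<Sum>\<^sub>\<infinity>n. f (?e n))"
      by (rule has_sum_imp_sums) (intro has_sum_infsum nonneg_summable_on_complete, simp)
    thus ?thesis by (simp add: sums_iff)
  qed
  also have "\<dots> = (\<Sum>\<^sub>\<infinity>x\<in>A. f x)"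
    by (rule infsum_reindex_bij_betw[OF bij])
  finally show ?thesis .
qed

text \<open>
  Summation and integration are exchanged. Then a term of level \<open>u\<close> survives only at the points whose
  peak exceeds \<open>u\<close>, and these form the closed neighbourhood of a superlevel set.
\<close>

lemma peak_energy_eq:
  assumes p: "1 \<le> p" and nonneg: "\<And>v. 0 \<le> g v" and fin: "\<And>t. 0 < t \<Longrightarrow> finite {v. t < g v}"
  shows "(\<Sum>\<^sub>\<infinity>v. ennreal ((peak g v - g v) powr p))
    = (\<integral>\<^sup>+u. (\<Sum>v\<in>closed_nbhd {x. u < g x}. pos_powr_deriv p u (g v)) * indicator {0<..} u \<partial>lborel)"
proof -
  have "(\<Sum>\<^sub>\<infinity>v. ennreal ((peak g v - g v) powr p))
      = (\<integral>\<^sup>+v. ennreal ((peak g v - g v) powr p) \<partial>count_space UNIV)"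
    by (rule nn_integral_count_space_eq_infsum[symmetric]) simp
  also have "\<dots> = (\<integral>\<^sup>+v. (\<integral>\<^sup>+u. pos_powr_deriv p u (g v) * indicator {0<..<peak g v} u \<partial>lborel) \<partial>count_space UNIV)"
    by (intro nn_integral_cong powr_layer_cake[symmetric] p nonneg peak_ge_self)
  also have "\<dots> = (\<integral>\<^sup>+u. (\<integral>\<^sup>+v. pos_powr_deriv p u (g v) * indicator {0<..<peak g v} u \<partial>count_space UNIV) \<partial>lborel)"
    by (rule nn_integral_count_space_nn_integral[symmetric]) (simp_all add: pos_powr_deriv_def)
  also have "\<dots> = (\<integral>\<^sup>+u. (\<Sum>v\<in>closed_nbhd {x. u < g x}. pos_powr_deriv p u (g v)) * indicator {0<..} u \<partial>lborel)"
  proof (rule nn_integral_cong)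
    fix u :: real
    show "(\<integral>\<^sup>+v. pos_powr_deriv p u (g v) * indicator {0<..<peak g v} u \<partial>count_space UNIV)
        = (\<Sum>v\<in>closed_nbhd {x. u < g x}. pos_powr_deriv p u (g v)) * indicator {0<..} u"
    proof (cases "0 < u")
      case True
      have "(\<integral>\<^sup>+v. pos_powr_deriv p u (g v) * indicator {0<..<peak g v} u \<partial>count_space UNIV)
          = (\<Sum>v\<in>closed_nbhd {x. u < g x}. pos_powr_deriv p u (g v) * indicator {0<..<peak g v} u)"
        using fin[OF True]
        by (intro nn_integral_count_space') (auto simp: finite_nbhd less_peak_iff[symmetric])
      also have "\<dots> = (\<Sum>v\<in>closed_nbhd {x. u < g x}. pos_powr_deriv p u (g v))"
        using True by (intro sum.cong) (auto simp: less_peak_iff[symmetric])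
      finally show ?thesis using True by simp
    qed simp
  qed
  finally show ?thesis .
qed

proposition peak_energy_rearrangement_le:
  assumes van: "vanishes_at_infinity f" and p: "1 \<le> p"
  shows "(\<Sum>\<^sub>\<infinity>v. ennreal ((peak (ww_rearrangement f) v - ww_rearrangement f v) powr p))
       \<le> (\<Sum>\<^sub>\<infinity>v. ennreal ((peak (\<lambda>x. \<bar>f x\<bar>) v - \<bar>f v\<bar>) powr p))"
proof -
  have "(\<Sum>\<^sub>\<infinity>v. ennreal ((peak (ww_rearrangement f) v - ww_rearrangement f v) powr p))
    = (\<integral>\<^sup>+u. (\<Sum>v\<in>closed_nbhd {x. u < ww_rearrangement f x}. pos_powr_deriv p u (ww_rearrangement f v))
        * indicator {0<..} u \<partial>lborel)"
    by (intro peak_energy_eq p ww_rearrangement_nonneg finite_superlevel_ww_rearrangement van)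
  also have "\<dots> \<le> (\<integral>\<^sup>+u. (\<Sum>v\<in>closed_nbhd {x. u < \<bar>f x\<bar>}. pos_powr_deriv p u \<bar>f v\<bar>) * indicator {0<..} u \<partial>lborel)"
    using sum_nbhd_superlevel_le[OF van antimono_pos_powr_deriv[OF p]]
    by (intro nn_integral_mono) (auto simp: indicator_def)
  also have "\<dots> = (\<Sum>\<^sub>\<infinity>v. ennreal ((peak (\<lambda>x. \<bar>f x\<bar>) v - \<bar>f v\<bar>) powr p))"
    by (intro peak_energy_eq[symmetric] p finite_superlevel van) auto
  finally show ?thesis .
qed

section \<open>Gradients\<close>

definition energy :: "real \<Rightarrow> (Z2 \<Rightarrow> real) \<Rightarrow> ennreal" where
  "energy p g = (\<Sum>\<^sub>\<infinity>(v, w)\<in>edges. ennreal (\<bar>g v - g w\<bar> powr p))"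

lemma infsum_inj_le:
  fixes F :: "'a \<Rightarrow> ennreal" and G :: "'b \<Rightarrow> ennreal"
  assumes inj: "inj_on h A" and h: "h ` A \<subseteq> B" and le: "\<And>x. x \<in> A \<Longrightarrow> F x \<le> G (h x)"
  shows "(\<Sum>\<^sub>\<infinity>x\<in>A. F x) \<le> (\<Sum>\<^sub>\<infinity>y\<in>B. G y)"
proof -
  have "(\<Sum>\<^sub>\<infinity>x\<in>A. F x) \<le> (\<Sum>\<^sub>\<infinity>x\<in>A. (G \<circ> h) x)"
    using le by (intro infsum_mono nonneg_summable_on_complete) auto
  also have "\<dots> = (\<Sum>\<^sub>\<infinity>y\<in>h ` A. G y)" by (rule infsum_reindex[OF inj, symmetric])
  also have "\<dots> \<le> (\<Sum>\<^sub>\<infinity>y\<in>B. G y)"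
    using h by (intro infsum_mono_neutral nonneg_summable_on_complete) auto
  finally show ?thesis .
qed

text \<open>
  A vertex \<open>v\<close> with a nonzero term is charged to the edge joining it to a neighbour \<open>m v\<close> where the
  peak is attained. The map is injective because $|f|$ is strictly smaller at \<open>v\<close> than at \<open>m v\<close>.
\<close>

lemma peak_energy_le_energy:
  assumes p: "0 \<le> p"
  shows "(\<Sum>\<^sub>\<infinity>v. ennreal ((peak (\<lambda>x. \<bar>f x\<bar>) v - \<bar>f v\<bar>) powr p)) \<le> energy p f"
proof -
  let ?h = "\<lambda>x. \<bar>f x\<bar>"
  define D where "D = {v. ?h v < peak ?h v}"
  obtain m where m: "\<And>v. m v \<in> closed_nbhd {v}" "\<And>v. peak ?h v = ?h (m v)"
    using peak_attained[of _ ?h] by metis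
  define e where "e v = (if (v, m v) \<in> edges then (v, m v) else (m v, v))" for v
  have mD: "adj v (m v)" "?h v < ?h (m v)" if "v \<in> D" for v
    using that m[of v] by (auto simp: D_def closed_nbhd_def)
  have "(\<Sum>\<^sub>\<infinity>v. ennreal ((peak ?h v - ?h v) powr p))
      = (\<Sum>\<^sub>\<infinity>v\<in>D. ennreal ((peak ?h v - ?h v) powr p))"
  proof (rule infsum_cong_neutral)
    show "ennreal ((peak ?h v - ?h v) powr p) = 0" if "v \<in> UNIV - D" for v
    proof -
      have "peak ?h v = ?h v" using that peak_ge_self[of ?h v] by (simp add: D_def)
      thus ?thesis by simp
    qed
  qed auto
  also have "\<dots> \<le> (\<Sum>\<^sub>\<infinity>y\<in>edges. (\<lambda>(v, w). ennreal (\<bar>f v - f w\<bar> powr p)) y)"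
  proof (rule infsum_inj_le)
    show "inj_on e D"
    proof (rule inj_onI, rule ccontr)
      fix v w assume vw: "v \<in> D" "w \<in> D" "e v = e w" "v \<noteq> w"
      hence "m v = w \<and> m w = v" by (auto simp: e_def split: if_splits)
      thus False using mD(2)[OF vw(1)] mD(2)[OF vw(2)] by simp
    qed
    show "e ` D \<subseteq> edges"
    proof
      fix y assume "y \<in> e ` D"
      then obtain v where "v \<in> D" "y = e v" by blast
      thus "y \<in> edges" using mD(1)[of v] adj_iff_edges[of v "m v"] by (auto simp: e_def)
    qed
    show "ennreal ((peak ?h v - ?h v) powr p) \<le> (\<lambda>(v, w). ennreal (\<bar>f v - f w\<bar> powr p)) (e v)"
      if "v \<in> D" for v
    proof -
      have "(peak ?h v - ?h v) powr p \<le> \<bar>f v - f (m v)\<bar> powr p"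
        using mD(2)[OF that] m(2)[of v] p by (intro powr_mono2) auto
      thus ?thesis by (auto simp: e_def abs_minus_commute intro: ennreal_leI)
    qed
  qed
  finally show ?thesis by (simp add: energy_def)
qed

lemma edge_cases:
  assumes "(v, w) \<in> edges"
  obtains (horizontal) a b where "v = (a, b)" "w = (a + 1, b)"
  | (vertical) a b where "v = (a, b)" "w = (a, b + 1)"
  using assms by (cases v; cases w) (auto simp: edges_def adj_iff)

definition outer_end :: "Z2 \<times> Z2 \<Rightarrow> Z2" where
  "outer_end = (\<lambda>(v, w). if l1_norm v < l1_norm w then w else v)"

definition inner_end :: "Z2 \<times> Z2 \<Rightarrow> Z2" where
  "inner_end = (\<lambda>(v, w). if l1_norm v < l1_norm w then v else w)"

lemma inner_end_less:
  assumes "e \<in> edges"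
  shows "l1_norm (inner_end e) < l1_norm (outer_end e)"
proof -
  obtain v w where e: "e = (v, w)" by (metis surj_pair)
  from assms[unfolded e] show ?thesis
    by (cases rule: edge_cases) (auto simp: e inner_end_def outer_end_def l1_norm_def)
qed

lemma inner_end_nbhd: "e \<in> edges \<Longrightarrow> inner_end e \<in> closed_nbhd {outer_end e}"
  by (cases e) (auto simp: inner_end_def outer_end_def closed_nbhd_def edges_def adj_sym)

definition horizontal_edges :: "(Z2 \<times> Z2) set" where
  "horizontal_edges = {(v, w) \<in> edges. snd v = snd w}"

lemma horizontal_edgeE:
  assumes "e \<in> horizontal_edges"
  obtains a b where "e = ((a, b), (a + 1, b))" "outer_end e = (if 0 \<le> a then a + 1 else a, b)"
proof -
  obtain v w where e: "e = (v, w)" by (metis surj_pair)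
  have "(v, w) \<in> edges" "snd v = snd w" using assms by (auto simp: horizontal_edges_def e)
  thus ?thesis
    by (cases rule: edge_cases) (auto simp: e outer_end_def l1_norm_def intro!: that)
qed

lemma vertical_edgeE:
  assumes "e \<in> edges - horizontal_edges"
  obtains a b where "e = ((a, b), (a, b + 1))" "outer_end e = (a, if 0 \<le> b then b + 1 else b)"
proof -
  obtain v w where e: "e = (v, w)" by (metis surj_pair)
  have "(v, w) \<in> edges" "snd v \<noteq> snd w" using assms by (auto simp: horizontal_edges_def e)
  thus ?thesis
    by (cases rule: edge_cases) (auto simp: e outer_end_def l1_norm_def intro!: that)
qed

lemma inj_outer_end_horizontal: "inj_on outer_end horizontal_edges"
  by (rule inj_onI, elim horizontal_edgeE) (simp split: if_splits)

lemma inj_outer_end_vertical: "inj_on outer_end (edges - horizontal_edges)"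
  by (rule inj_onI, elim vertical_edgeE) (simp split: if_splits)

text \<open>
  Each edge is charged to its outer end, where the peak is at least the value at the inner
  end; the horizontal edges have distinct outer ends, and so have the vertical ones.
\<close>

lemma energy_le_peak_energy:
  assumes p: "0 \<le> p" and mono: "\<And>v w. l1_norm v < l1_norm w \<Longrightarrow> g w \<le> g v"
  shows "energy p g \<le> 2 * (\<Sum>\<^sub>\<infinity>v. ennreal ((peak g v - g v) powr p))"
proof -
  define \<phi> where "\<phi> = (\<lambda>(v, w). ennreal (\<bar>g v - g w\<bar> powr p))"
  define K where "K = (\<Sum>\<^sub>\<infinity>v. ennreal ((peak g v - g v) powr p))"
  have le: "\<phi> e \<le> ennreal ((peak g (outer_end e) - g (outer_end e)) powr p)" if "e \<in> edges" for e
  proof -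
    have "\<phi> e = ennreal (\<bar>g (inner_end e) - g (outer_end e)\<bar> powr p)"
      by (cases e) (simp add: \<phi>_def inner_end_def outer_end_def abs_minus_commute)
    also have "\<dots> \<le> ennreal ((peak g (outer_end e) - g (outer_end e)) powr p)"
      using p mono[OF inner_end_less[OF that]] peak_ge[OF inner_end_nbhd[OF that], of g]
      by (intro ennreal_leI powr_mono2) auto
    finally show ?thesis .
  qed
  have "energy p g = (\<Sum>\<^sub>\<infinity>e\<in>horizontal_edges \<union> (edges - horizontal_edges). \<phi> e)"
    unfolding energy_def \<phi>_def by (rule arg_cong2[where f = infsum]) (auto simp: horizontal_edges_def)
  also have "\<dots> = (\<Sum>\<^sub>\<infinity>e\<in>horizontal_edges. \<phi> e) + (\<Sum>\<^sub>\<infinity>e\<in>edges - horizontal_edges. \<phi> e)"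
    by (intro infsum_Un_disjoint nonneg_summable_on_complete) auto
  also have "\<dots> \<le> K + K"
    unfolding K_def
    by (intro add_mono infsum_inj_le[OF inj_outer_end_horizontal] infsum_inj_le[OF inj_outer_end_vertical])
      (auto intro!: le simp: horizontal_edges_def)
  finally show ?thesis by (simp add: K_def mult_2)
qed

context
  fixes f :: "Z2 \<Rightarrow> real"
  assumes van: "vanishes_at_infinity f"
begin

lemma ww_rearrangement_l1_mono:
  "l1_norm v < l1_norm w \<Longrightarrow> ww_rearrangement f w \<le> ww_rearrangement f v"
  by (rule ww_rearrangement_antimono[OF van]) (simp add: ww_le_iff ww_less_def)

proposition energy_rearrangement_le:
  assumes p: "1 \<le> p"
  shows "energy p (ww_rearrangement f) \<le> 2 * energy p f"
proof -
  have "energy p (ww_rearrangement f)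
      \<le> 2 * (\<Sum>\<^sub>\<infinity>v. ennreal ((peak (ww_rearrangement f) v - ww_rearrangement f v) powr p))"
    using p by (intro energy_le_peak_energy ww_rearrangement_l1_mono) auto
  also have "\<dots> \<le> 2 * (\<Sum>\<^sub>\<infinity>v. ennreal ((peak (\<lambda>x. \<bar>f x\<bar>) v - \<bar>f v\<bar>) powr p))"
    by (intro mult_left_mono peak_energy_rearrangement_le van p) auto
  also have "\<dots> \<le> 2 * energy p f"
    using p by (intro mult_left_mono peak_energy_le_energy) auto
  finally show ?thesis .
qed

text \<open>
  If the rearrangement dropped by more than \<open>D\<close> along an edge from \<open>w\<close> to \<open>v\<close>, a level \<open>s\<close> could be
  placed above its value at \<open>v\<close> such that \<open>s + D\<close> is still below its value at \<open>w\<close>. Then \<open>v\<close> lies in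
  the closed neighbourhood of the superlevel set at \<open>s + D\<close>. This neighbourhood is an initial
  segment, and it is at most as large as the corresponding neighbourhood for $|f|$, which is
  contained in the superlevel set of $|f|$ at \<open>s\<close>. So \<open>v\<close> comes early enough in the order to have a
  value above \<open>s\<close>.
\<close>

proposition gradient_sup_rearrangement_le:
  assumes D: "\<And>v w. adj v w \<Longrightarrow> \<bar>f v - f w\<bar> \<le> D" and e: "e \<in> edges"
  shows "\<bar>ww_rearrangement f (fst e) - ww_rearrangement f (snd e)\<bar> \<le> D"
proof -
  let ?g = "ww_rearrangement f"
  define v where "v = outer_end e"
  define w where "w = inner_end e"
  have "\<bar>?g (fst e) - ?g (snd e)\<bar> = ?g w - ?g v"
  proof -
    have "?g v \<le> ?g w"
      using ww_rearrangement_l1_mono[OF inner_end_less[OF e]] by (simp add: v_def w_def)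
    thus ?thesis by (auto simp: v_def w_def inner_end_def outer_end_def split: prod.splits if_splits)
  qed
  moreover have "?g w - ?g v \<le> D"
  proof (rule ccontr)
    assume "\<not> ?g w - ?g v \<le> D"
    then obtain s where s: "?g v < s" "s < ?g w - D" by (metis dense not_le less_diff_eq add.commute)
    have D0: "0 \<le> D" using D[of 0 "(1, 0)"] by (simp add: adj_def l1_norm_def)
    have s0: "0 < s" using s(1) ww_rearrangement_nonneg[OF van, of v] by linarith
    have sD: "0 < s + D" using s0 D0 by simp
    have "w \<in> {x. s + D < ?g x}" "v \<in> closed_nbhd {w}"
      using inner_end_nbhd[OF e] s(2) by (simp_all add: v_def w_def nbhd_sym)
    hence v: "v \<in> closed_nbhd {x. s + D < ?g x}" by (subst nbhd_UN) blast
    have "closed_nbhd {x. s + D < \<bar>f x\<bar>} \<subseteq> {x. s < \<bar>f x\<bar>}"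
      using D D0 by (fastforce simp: closed_nbhd_def)
    hence "card (closed_nbhd {x. s + D < \<bar>f x\<bar>}) \<le> card {x. s < \<bar>f x\<bar>}"
      by (intro card_mono finite_superlevel[OF van s0])
    moreover have "card (segment v) \<le> card (closed_nbhd {x. s + D < ?g x})"
      using van sD
    proof (cases rule: superlevel_ww_rearrangement)
      case empty
      thus ?thesis using v by (simp add: closed_nbhd_def)
    next
      case (segment z)
      thus ?thesis using v
        by (simp add: nbhd_segment card_segment_le_iff) (simp add: segment_def)
    qed
    ultimately have "card (segment v) \<le> card {x. s < \<bar>f x\<bar>}"
      using card_nbhd_superlevel[OF van sD] by linarith
    hence "s < ?g v" using less_ww_rearrangement_iff[OF van s0] by blast
    thus False using s(1) by simp
  qed
  ultimately show ?thesis by simp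
qed

end

lemma ennreal_rpow_mono:
  assumes "0 \<le> a" "s \<le> t"
  shows "ennreal_rpow s a \<le> ennreal_rpow t a"
  using assms
  by (auto simp: ennreal_rpow_def top_unique less_top[symmetric] intro!: ennreal_leI powr_mono2 enn2real_mono)

lemma ennreal_rpow_double: "ennreal_rpow (2 * s) a = ennreal (2 powr a) * ennreal_rpow s a"
  by (auto simp: ennreal_rpow_def ennreal_mult_eq_top_iff ennreal_mult_top enn2real_mult powr_mult
      simp flip: ennreal_mult)

theorem theorem1p5:
  fixes f :: "int \<times> int \<Rightarrow> real" and p :: ennreal
  assumes "vanishes_at_infinity f" and "1 \<le> p"
  shows "grad_norm p (ww_rearrangement f) \<le> ennreal (2 powr enn2real (1 / p)) * grad_norm p f"
proof (cases "p = \<infinity>")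
  case True
  have "grad_norm \<infinity> (ww_rearrangement f) \<le> grad_norm \<infinity> f"
  proof (cases "grad_norm \<infinity> f = \<infinity>")
    case False
    define D where "D = enn2real (grad_norm \<infinity> f)"
    have gD: "grad_norm \<infinity> f = ennreal D" using False by (simp add: D_def less_top)
    have "0 \<le> D" by (simp add: D_def)
    have "\<bar>f v - f w\<bar> \<le> D" if "(v, w) \<in> edges" for v w
    proof -
      have "ennreal \<bar>f v - f w\<bar> \<le> grad_norm \<infinity> f"
        unfolding grad_norm_def using that by (auto intro!: SUP_upper2[of "(v, w)"])
      thus ?thesis using \<open>0 \<le> D\<close> unfolding gD by simp
    qed
    hence "\<bar>f v - f w\<bar> \<le> D" if "adj v w" for v w
      using that adj_iff_edges[of v w] by (metis abs_minus_commute)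
    hence "\<bar>ww_rearrangement f v - ww_rearrangement f w\<bar> \<le> D" if "(v, w) \<in> edges" for v w
      using gradient_sup_rearrangement_le[OF assms(1) _ that, of D] by simp
    hence "grad_norm \<infinity> (ww_rearrangement f) \<le> ennreal D"
      unfolding grad_norm_def by (auto intro!: SUP_least ennreal_leI)
    thus ?thesis unfolding gD .
  qed simp
  thus ?thesis using True by simp
next
  case False
  define q where "q = enn2real p"
  have pq: "p = ennreal q" using False by (simp add: q_def less_top)
  have q: "1 \<le> q" using assms(2) unfolding pq by simp
  have inv: "enn2real (1 / p) = 1 / q"
    using q unfolding pq by (simp add: divide_ennreal flip: ennreal_1)
  have grad: "grad_norm p g = ennreal_rpow (energy q g) (1 / q)" for g
    using False by (simp add: grad_norm_def energy_def q_def)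
  have "ennreal_rpow (energy q (ww_rearrangement f)) (1 / q) \<le> ennreal_rpow (2 * energy q f) (1 / q)"
    using q by (intro ennreal_rpow_mono energy_rearrangement_le assms) auto
  thus ?thesis by (simp add: grad inv ennreal_rpow_double)
qed

end
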